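(* Let $m,n\ge 2$ with $\max\{m,n\}\ge3$ (so that $K_{m,n}$ contains a copy of $K_{2,3}$). The matroid ${\mathcal M}_{f_{1,0}}(K_{m,n})$ is the unique maximal $K_{2,3}$-matroid on $K_{m,n}$ and ${\rm val}_{K_{2,3}}$ is its rank function.
   Context: $f_{1,0}(F)=|V(F)|$ for $F\subseteq E(K_{m,n})$, $V(F)$ the set of vertices incident to $F$; ${\mathcal M}_{f_{1,0}}(K_{m,n})$ is the matroid on $E(K_{m,n})$ whose independent sets are those $F$ with $|I|\le |V(I)|$ for every nonempty $I\subseteq F$. A $K_{2,3}$-matroid on $K_{m,n}$ is a matroid on $E(K_{m,n})$ in which the edge set of every subgraph isomorphic to $K_{2,3}$ is a circuit; maximality is in the weak order (${\mathcal M}_1\preceq{\mathcal M}_2$ if every independent set of ${\mathcal M}_1$ is independent in ${\mathcal M}_2$). With ${\mathcal X}$ the family of edge sets of copies of $K_{2,3}$ in $K_{m,n}$: a proper ${\mathcal X}$-sequence is $(X_1,\dots,X_k)$ in ${\mathcal X}$ with $X_i\not\subseteq\bigcup_{j<i}X_j$ for $i\ge2$; ${\rm val}(F,{\mathcal S})=|F\cup\bigcup_iX_i|-k$; ${\rm val}_{K_{2,3}}(F)=\min_{\mathcal S}{\rm val}(F,{\mathcal S})$. *)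

theory Defs
  imports Main
begin

text \<open>A matroid on a finite ground set is represented by its family of independent sets.\<close>

definition matroid_on :: "'a set \<Rightarrow> 'a set set \<Rightarrow> bool" where
  "matroid_on E M \<longleftrightarrow>
     finite E \<and> M \<subseteq> Pow E \<and> {} \<in> M \<and>
     (\<forall>A\<in>M. \<forall>B. B \<subseteq> A \<longrightarrow> B \<in> M) \<and>
     (\<forall>A\<in>M. \<forall>B\<in>M. card A < card B \<longrightarrow> (\<exists>x\<in>B - A. insert x A \<in> M))"

definition circuit :: "'a set \<Rightarrow> 'a set set \<Rightarrow> 'a set \<Rightarrow> bool" where
  "circuit E M C \<longleftrightarrow> C \<subseteq> E \<and> C \<notin> M \<and> (\<forall>D. D \<subset> C \<longrightarrow> D \<in> M)"

definition matroid_rank :: "'a set set \<Rightarrow> 'a set \<Rightarrow> nat" where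
  "matroid_rank M F = Max {card A | A. A \<subseteq> F \<and> A \<in> M}"

definition weak_le :: "'a set set \<Rightarrow> 'a set set \<Rightarrow> bool" where
  "weak_le M1 M2 \<longleftrightarrow> (\<forall>A. A \<in> M1 \<longrightarrow> A \<in> M2)"

text \<open>Independent sets of the count matroid induced by \<open>f\<close> on \<open>E\<close>.\<close>

definition count_matroid :: "('a set \<Rightarrow> nat) \<Rightarrow> 'a set \<Rightarrow> 'a set set" where
  "count_matroid f E = {F. F \<subseteq> E \<and> (\<forall>I. I \<subseteq> F \<longrightarrow> I \<noteq> {} \<longrightarrow> card I \<le> f I)}"

definition proper_seq :: "'a set set \<Rightarrow> 'a set list \<Rightarrow> bool" where
  "proper_seq X S \<longleftrightarrow> set S \<subseteq> X \<and>
     (\<forall>i. 1 \<le> i \<longrightarrow> i < length S \<longrightarrow> \<not> S ! i \<subseteq> (\<Union>j<i. S ! j))"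

text \<open>The empty sequence is proper, so that \<open>val_min X F \<le> card F\<close>.\<close>

definition val :: "'a set \<Rightarrow> 'a set list \<Rightarrow> int" where
  "val F S = int (card (F \<union> \<Union> (set S))) - int (length S)"

definition val_min :: "'a set set \<Rightarrow> 'a set \<Rightarrow> int" where
  "val_min X F = Min {val F S | S. proper_seq X S}"

text \<open>Edges are two-element sets of vertices; the two sides of \<open>K\<^sub>m\<^sub>,\<^sub>n\<close> are the
  vertices \<open>Inl i\<close> with \<open>i < m\<close> and \<open>Inr j\<close> with \<open>j < n\<close>.\<close>

definition K_verts :: "nat \<Rightarrow> nat \<Rightarrow> (nat + nat) set" where
  "K_verts m n = Inl ` {..<m} \<union> Inr ` {..<n}"

definition K_edges :: "nat \<Rightarrow> nat \<Rightarrow> (nat + nat) set set" where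
  "K_edges m n = {{Inl i, Inr j} | i j. i < m \<and> j < n}"

text \<open>Edge sets of subgraphs of \<open>K\<^sub>m\<^sub>,\<^sub>n\<close> isomorphic to \<open>K\<^sub>2\<^sub>,\<^sub>3\<close>. The
  isomorphism \<open>\<phi>\<close> may place the side of size two on either side of \<open>K\<^sub>m\<^sub>,\<^sub>n\<close>.\<close>

definition K23_copies :: "nat \<Rightarrow> nat \<Rightarrow> (nat + nat) set set set" where
  "K23_copies m n =
     {X. X \<subseteq> K_edges m n \<and>
         (\<exists>\<phi> :: nat + nat \<Rightarrow> nat + nat.
            inj_on \<phi> (K_verts 2 3) \<and> X = (\<lambda>e. \<phi> ` e) ` K_edges 2 3)}"

definition K23_matroid :: "nat \<Rightarrow> nat \<Rightarrow> (nat + nat) set set set \<Rightarrow> bool" where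
  "K23_matroid m n M \<longleftrightarrow>
     matroid_on (K_edges m n) M \<and> (\<forall>X\<in>K23_copies m n. circuit (K_edges m n) M X)"

definition maximal_K23_matroid :: "nat \<Rightarrow> nat \<Rightarrow> (nat + nat) set set set \<Rightarrow> bool" where
  "maximal_K23_matroid m n M \<longleftrightarrow>
     K23_matroid m n M \<and> (\<forall>N. K23_matroid m n N \<longrightarrow> weak_le M N \<longrightarrow> N = M)"

definition f10 :: "'v set set \<Rightarrow> nat" where
  "f10 F = card (\<Union> F)"

abbreviation M_f10 :: "nat \<Rightarrow> nat \<Rightarrow> (nat + nat) set set set" where
  "M_f10 m n \<equiv> count_matroid f10 (K_edges m n)"

abbreviation val_K23 :: "nat \<Rightarrow> nat \<Rightarrow> (nat + nat) set set \<Rightarrow> int" where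
  "val_K23 m n \<equiv> val_min (K23_copies m n)"

text \<open>The minimum in \<open>val_K23\<close> ranges over a finite nonempty set.\<close>

lemma finite_K_edges: "finite (K_edges m n)"
proof -
  have "K_edges m n = (\<lambda>(i, j). {Inl i, Inr j}) ` ({..<m} \<times> {..<n})"
    by (auto simp: K_edges_def)
  then show ?thesis by simp
qed

lemma finite_K23_copies: "finite (K23_copies m n)"
  by (rule finite_subset[of _ "Pow (K_edges m n)"])
    (auto simp: K23_copies_def finite_K_edges)

lemma proper_seq_distinct:
  assumes "proper_seq X S"
  shows "distinct S"
proof -
  have "S ! i \<noteq> S ! j" if "i < j" "j < length S" for i j
    using assms that unfolding proper_seq_def by (metis UN_upper lessThan_iff less_one not_le less_nat_zero_code)
  then show ?thesis
    unfolding distinct_conv_nth by (metis nat_neq_iff)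
qed

lemma finite_proper_seqs: "finite X \<Longrightarrow> finite {S. proper_seq X S}"
  by (rule finite_subset[OF _ finite_subset_distinct[of X]])
    (auto simp: proper_seq_distinct, auto simp: proper_seq_def)

lemma finite_val_K23_values: "finite {val F S | S. proper_seq (K23_copies m n) S}"
  using finite_proper_seqs[OF finite_K23_copies] by simp

lemma proper_seq_Nil: "proper_seq X []"
  by (simp add: proper_seq_def)

end

theory Submission
  imports Defs
begin

text \<open>In a matroid whose circuits include the family \<open>\<X>\<close>, each member of a proper sequence
  takes the rank of the union one further below its cardinality, so \<open>val_min \<X>\<close> bounds the rank
  from above. Hence any such matroid whose rank attains the bound is the largest one.

  For the count matroid of a polymatroid function \<open>f\<close>, let \<open>I\<close> be a basis of \<open>F\<close> and \<open>T\<close> the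
  largest subset of \<open>I\<close> with \<open>card T = f T\<close>. Adding elements of \<open>F - I\<close> to \<open>T\<close> does not increase
  \<open>f\<close>, so \<open>Z = T \<union> (F - I)\<close> satisfies \<open>card I = card (F - Z) + f Z\<close>. It remains to bound
  \<open>val_min \<X>\<close> by the number of vertices. Adding an edge that completes a copy of \<open>K\<^sub>2\<^sub>,\<^sub>3\<close> does not
  increase \<open>val_min \<X>\<close>, so a complete bipartite graph gains at most one with every new vertex
  beyond \<open>K\<^sub>2\<^sub>,\<^sub>2\<close>: the first new edge costs one, and every further one completes a copy.\<close>

section \<open>Bases and rank\<close>

definition is_basis :: "'a set set \<Rightarrow> 'a set \<Rightarrow> 'a set \<Rightarrow> bool" where
  "is_basis M F B \<longleftrightarrow> B \<subseteq> F \<and> B \<in> M \<and> (\<forall>x\<in>F - B. insert x B \<notin> M)"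

locale matroid =
  fixes E :: "'a set" and M :: "'a set set"
  assumes matroid_on: "matroid_on E M"
begin

lemma finite_ground: "finite E"
  using matroid_on by (simp add: matroid_on_def)

lemma indep_subset_ground: "A \<in> M \<Longrightarrow> A \<subseteq> E"
  using matroid_on by (auto simp: matroid_on_def)

lemma finite_indep: "A \<in> M \<Longrightarrow> finite A"
  using finite_ground indep_subset_ground by (rule finite_subset[rotated])

lemma empty_indep: "{} \<in> M"
  using matroid_on by (simp add: matroid_on_def)

lemma indep_subset: "A \<in> M \<Longrightarrow> B \<subseteq> A \<Longrightarrow> B \<in> M"
  using matroid_on unfolding matroid_on_def by blast

lemma indep_augment:
  assumes "A \<in> M" "B \<in> M" "card A < card B"
  obtains x where "x \<in> B - A" "insert x A \<in> M"
  using assms matroid_on unfolding matroid_on_def by metis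

lemma extend_to_basis:
  assumes "A \<in> M" "A \<subseteq> F"
  obtains B where "A \<subseteq> B" "is_basis M F B"
proof -
  let ?\<B> = "{B \<in> M. B \<subseteq> F}"
  have "finite ?\<B>"
    by (rule finite_subset[of _ "Pow E"]) (auto simp: finite_ground dest: indep_subset_ground)
  moreover have "A \<in> ?\<B>"
    using assms by simp
  ultimately obtain B where B: "B \<in> ?\<B>" "A \<subseteq> B"
    and maximal: "\<forall>C\<in>?\<B>. B \<subseteq> C \<longrightarrow> B = C"
    by (rule finite_has_maximal2[THEN bexE]) auto
  have "insert x B \<notin> M" if "x \<in> F - B" for x
    using maximal B that by blast
  with B have "is_basis M F B"
    by (simp add: is_basis_def)
  with B(2) show thesis
    by (rule that)
qed

lemma card_indep_le_card_basis:
  assumes "is_basis M F B" "J \<in> M" "J \<subseteq> F"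
  shows "card J \<le> card B"
proof (rule ccontr)
  assume "\<not> card J \<le> card B"
  then obtain x where "x \<in> J - B" "insert x B \<in> M"
    using assms indep_augment[of B J] by (auto simp: is_basis_def)
  then show False
    using assms by (auto simp: is_basis_def)
qed

lemma rank_eq_card_basis:
  assumes "is_basis M F B"
  shows "matroid_rank M F = card B"
  unfolding matroid_rank_def
proof (rule Max_eqI)
  have "{card A |A. A \<subseteq> F \<and> A \<in> M} \<subseteq> {..card B}"
    using card_indep_le_card_basis[OF assms] by auto
  then show "finite {card A |A. A \<subseteq> F \<and> A \<in> M}"
    by (rule finite_subset) simp
  show "card B \<in> {card A |A. A \<subseteq> F \<and> A \<in> M}"
    using assms by (auto simp: is_basis_def)
qed (use card_indep_le_card_basis[OF assms] in auto)

lemma basis_exists: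
  obtains B where "is_basis M F B"
  using extend_to_basis[OF empty_indep empty_subsetI] by blast

lemma card_indep_le_rank:
  assumes "J \<in> M" "J \<subseteq> F"
  shows "card J \<le> matroid_rank M F"
proof -
  obtain B where B: "is_basis M F B"
    by (rule basis_exists)
  show ?thesis
    using card_indep_le_card_basis[OF B assms] by (simp add: rank_eq_card_basis[OF B])
qed

lemma rank_attained:
  obtains B where "B \<in> M" "B \<subseteq> F" "card B = matroid_rank M F"
proof -
  obtain B where "is_basis M F B"
    by (rule basis_exists)
  then show thesis
    using that[of B] rank_eq_card_basis[of F B] by (simp add: is_basis_def)
qed

lemma rank_mono:
  assumes "F \<subseteq> G"
  shows "matroid_rank M F \<le> matroid_rank M G"
proof -
  obtain B where "B \<in> M" "B \<subseteq> F" "card B = matroid_rank M F"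
    by (rule rank_attained)
  with assms show ?thesis
    using card_indep_le_rank[of B G] by simp
qed

lemma rank_Un_le:
  assumes "finite D"
  shows "matroid_rank M (F \<union> D) \<le> matroid_rank M F + card D"
proof -
  obtain B where B: "B \<in> M" "B \<subseteq> F \<union> D" "card B = matroid_rank M (F \<union> D)"
    by (rule rank_attained)
  have "card B \<le> card ((B \<inter> F) \<union> D)"
    using B(2) assms finite_indep[OF B(1)] by (intro card_mono) auto
  also have "\<dots> \<le> card (B \<inter> F) + card D"
    by (rule card_Un_le)
  also have "card (B \<inter> F) \<le> matroid_rank M F"
    using indep_subset[OF B(1)] by (intro card_indep_le_rank) auto
  finally show ?thesis
    using B(3) by simp
qed

lemma indep_if_card_le_rank:
  assumes "finite J" "card J \<le> matroid_rank M J"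
  shows "J \<in> M"
proof -
  obtain B where "B \<in> M" "B \<subseteq> J" "card B = matroid_rank M J"
    by (rule rank_attained)
  with assms show ?thesis
    using card_seteq[of J B] by simp
qed

lemma rank_Diff_singleton_of_circuit:
  assumes C: "circuit E M C" "C \<subseteq> F" and e: "e \<in> C"
  shows "matroid_rank M (F - {e}) = matroid_rank M F"
proof -
  have "C - {e} \<in> M"
    using C(1) e by (auto simp: circuit_def)
  then obtain B where circuit_rest: "C - {e} \<subseteq> B" and B: "is_basis M (F - {e}) B"
    using extend_to_basis[of "C - {e}" "F - {e}"] C(2) by blast
  have "insert e B \<notin> M"
    using indep_subset[of "insert e B" C] circuit_rest C(1) by (auto simp: circuit_def)
  with B have "is_basis M F B"
    by (auto simp: is_basis_def)
  then show ?thesis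
    using rank_eq_card_basis[OF B] rank_eq_card_basis[of F B] by simp
qed

end

section \<open>Values of proper sequences\<close>

lemma proper_seq_iff_take:
  "proper_seq \<X> S \<longleftrightarrow>
     set S \<subseteq> \<X> \<and> (\<forall>i<length S. 1 \<le> i \<longrightarrow> \<not> S ! i \<subseteq> \<Union>(set (take i S)))"
proof -
  have "(\<Union>j<i. S ! j) = \<Union>(set (take i S))" if "i < length S" for i
    using nth_image[of i S] that by (simp add: lessThan_atLeast0)
  then show ?thesis
    unfolding proper_seq_def by auto
qed

lemma proper_seq_snoc:
  "proper_seq \<X> (S @ [X]) \<longleftrightarrow>
     proper_seq \<X> S \<and> X \<in> \<X> \<and> (S \<noteq> [] \<longrightarrow> \<not> X \<subseteq> \<Union>(set S))"
  unfolding proper_seq_iff_take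
  by (simp add: All_less_Suc nth_append Suc_le_eq) auto

context
  fixes \<X> :: "'a set set"
  assumes finite_family: "finite \<X>"
begin

lemma finite_vals: "finite {val F S | S. proper_seq \<X> S}"
  using finite_proper_seqs[OF finite_family] by simp

lemma val_min_le: "proper_seq \<X> S \<Longrightarrow> val_min \<X> F \<le> val F S"
  unfolding val_min_def by (intro Min_le finite_vals) blast

lemma val_min_attained:
  obtains S where "proper_seq \<X> S" "val F S = val_min \<X> F"
proof -
  have "val_min \<X> F \<in> {val F S | S. proper_seq \<X> S}"
    unfolding val_min_def using proper_seq_Nil by (intro Min_in finite_vals) blast
  then show thesis
    using that by auto
qed

lemma val_min_le_card: "val_min \<X> F \<le> int (card F)"
  using val_min_le[OF proper_seq_Nil, of F] by (simp add: val_def)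

lemma val_min_mono:
  assumes "F \<subseteq> G" "finite G" "\<And>X. X \<in> \<X> \<Longrightarrow> finite X"
  shows "val_min \<X> F \<le> val_min \<X> G"
proof -
  obtain S where S: "proper_seq \<X> S" "val G S = val_min \<X> G"
    by (rule val_min_attained)
  have "finite (G \<union> \<Union>(set S))"
    using assms S(1) by (auto simp: proper_seq_def)
  then have "val F S \<le> val G S"
    unfolding val_def using assms(1) by (auto intro!: card_mono)
  then show ?thesis
    using val_min_le[OF S(1), of F] S(2) by simp
qed

lemma val_min_Un_le: "val_min \<X> (F \<union> D) \<le> val_min \<X> F + int (card D)"
proof -
  obtain S where S: "proper_seq \<X> S" "val F S = val_min \<X> F"
    by (rule val_min_attained)
  have "val (F \<union> D) S \<le> val F S + int (card D)"
    using card_Un_le[of "F \<union> \<Union>(set S)" D] by (simp add: val_def Un_ac)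
  then show ?thesis
    using val_min_le[OF S(1), of "F \<union> D"] S(2) by simp
qed

lemma val_min_insert_le:
  assumes X: "X \<in> \<X>" "e \<in> X" "X \<subseteq> insert e F"
  shows "val_min \<X> (insert e F) \<le> val_min \<X> F"
proof -
  obtain S where S: "proper_seq \<X> S" "val F S = val_min \<X> F"
    by (rule val_min_attained)
  let ?W = "F \<union> \<Union>(set S)"
  show ?thesis
  proof (cases "e \<in> ?W")
    case True
    then have "val (insert e F) S = val F S"
      by (simp add: val_def insert_absorb)
    then show ?thesis
      using val_min_le[OF S(1), of "insert e F"] S(2) by simp
  next
    case False
    have "insert e F \<union> \<Union>(set (S @ [X])) = insert e ?W"
      using X by auto
    then have "val (insert e F) (S @ [X]) \<le> val F S"
      using card_Un_le[of "{e}" ?W] by (simp add: val_def)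
    moreover have "proper_seq \<X> (S @ [X])"
      using S(1) X False by (auto simp: proper_seq_snoc)
    ultimately show ?thesis
      using val_min_le[of "S @ [X]" "insert e F"] S(2) by simp
  qed
qed

end

section \<open>Matroids with prescribed circuits\<close>

locale matroid_with_circuits = matroid +
  fixes \<X> :: "'a set set"
  assumes circuit: "X \<in> \<X> \<Longrightarrow> circuit E M X"
begin

lemma family_subset: "\<X> \<subseteq> Pow E"
  using circuit by (auto simp: circuit_def)

lemma finite_family: "finite \<X>"
  using family_subset finite_ground by (metis finite_Pow_iff finite_subset)

lemma proper_seq_Union_subset: "proper_seq \<X> S \<Longrightarrow> \<Union>(set S) \<subseteq> E"
  using family_subset by (auto simp: proper_seq_def)

lemma rank_proper_seq_Union:
  assumes "proper_seq \<X> S"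
  shows "matroid_rank M (\<Union>(set S)) + length S \<le> card (\<Union>(set S))"
  using assms
proof (induction S rule: rev_induct)
  case Nil
  then show ?case
    using rank_attained[of "{}"] by auto
next
  case (snoc X S)
  let ?W = "\<Union>(set S)"
  have S: "proper_seq \<X> S" and X: "circuit E M X" and new: "S \<noteq> [] \<longrightarrow> \<not> X \<subseteq> ?W"
    using snoc.prems circuit by (auto simp: proper_seq_snoc)
  have finite_Un: "finite (?W \<union> X)"
    using proper_seq_Union_subset[OF snoc.prems] finite_ground
    by (auto intro: finite_subset)
  have "X \<noteq> {}"
    using X empty_indep by (auto simp: circuit_def)
  with new obtain e where e: "e \<in> X" "e \<notin> ?W"
    by (cases S) auto
  have "matroid_rank M (?W \<union> X) = matroid_rank M (?W \<union> X - {e})"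
    using rank_Diff_singleton_of_circuit[OF X _ e(1)] by simp
  also have "?W \<union> X - {e} = ?W \<union> (X - ?W - {e})"
    using e by auto
  also have "matroid_rank M \<dots> \<le> matroid_rank M ?W + card (X - ?W - {e})"
    using finite_Un by (intro rank_Un_le) auto
  finally have "matroid_rank M (?W \<union> X) \<le> matroid_rank M ?W + card (X - ?W - {e})" .
  moreover have "Suc (card (X - ?W - {e})) = card (X - ?W)"
    using e finite_Un by (intro card.remove[symmetric]) auto
  moreover have "card (?W \<union> X) = card ?W + card (X - ?W)"
    using finite_Un card_Un_disjoint[of ?W "X - ?W"] by simp
  ultimately show ?case
    using snoc.IH[OF S] by (simp add: Un_commute)
qed

lemma rank_le_val:
  assumes "proper_seq \<X> S" "F \<subseteq> E"
  shows "int (matroid_rank M F) \<le> val F S"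
proof -
  let ?W = "\<Union>(set S)"
  have finite_Un: "finite (F \<union> ?W)"
    using proper_seq_Union_subset[OF assms(1)] assms(2) finite_ground
    by (auto intro: finite_subset)
  have "matroid_rank M F \<le> matroid_rank M (?W \<union> (F - ?W))"
    by (rule rank_mono) blast
  also have "\<dots> \<le> matroid_rank M ?W + card (F - ?W)"
    using finite_Un by (intro rank_Un_le) auto
  finally have "matroid_rank M F + length S \<le> card ?W + card (F - ?W)"
    using rank_proper_seq_Union[OF assms(1)] by linarith
  also have "\<dots> = card (F \<union> ?W)"
    using finite_Un card_Un_disjoint[of ?W "F - ?W"] by (simp add: Un_commute)
  finally show ?thesis
    by (simp add: val_def)
qed

lemma rank_le_val_min:
  assumes "F \<subseteq> E"
  shows "int (matroid_rank M F) \<le> val_min \<X> F"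
proof -
  obtain S where "proper_seq \<X> S" "val F S = val_min \<X> F"
    by (rule val_min_attained[OF finite_family])
  then show ?thesis
    using rank_le_val[OF _ assms, of S] by simp
qed

lemma weak_le_if_val_min_le_rank:
  assumes "matroid E M'"
    and val_min_le_rank: "\<And>F. F \<subseteq> E \<Longrightarrow> val_min \<X> F \<le> int (matroid_rank M' F)"
  shows "weak_le M M'"
  unfolding weak_le_def
proof (intro allI impI)
  interpret M': matroid E M' by fact
  fix J assume J: "J \<in> M"
  have "int (card J) \<le> int (matroid_rank M J)"
    using card_indep_le_rank[OF J] by simp
  also have "\<dots> \<le> val_min \<X> J"
    using J by (intro rank_le_val_min indep_subset_ground)
  also have "\<dots> \<le> int (matroid_rank M' J)"
    using J by (intro val_min_le_rank indep_subset_ground)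
  finally show "J \<in> M'"
    using finite_indep[OF J] by (intro M'.indep_if_card_le_rank) auto
qed

end

section \<open>Count matroids of polymatroid functions\<close>

locale polymatroid =
  fixes E :: "'a set" and f :: "'a set \<Rightarrow> nat"
  assumes finite_ground: "finite E"
    and f_empty: "f {} = 0"
    and f_mono: "A \<subseteq> B \<Longrightarrow> B \<subseteq> E \<Longrightarrow> f A \<le> f B"
    and f_submodular: "A \<subseteq> E \<Longrightarrow> B \<subseteq> E \<Longrightarrow> f (A \<union> B) + f (A \<inter> B) \<le> f A + f B"
begin

lemma mem_count_matroid_iff: "I \<in> count_matroid f E \<longleftrightarrow> I \<subseteq> E \<and> (\<forall>T\<subseteq>I. card T \<le> f T)"
proof -
  have "(T \<noteq> {} \<longrightarrow> card T \<le> f T) \<longleftrightarrow> card T \<le> f T" for T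
    by (cases "T = {}") (simp_all add: f_empty)
  then show ?thesis
    by (simp add: count_matroid_def)
qed

lemma f_insert_eq_superset:
  assumes "f (insert x S) = f S" "S \<subseteq> T" "insert x T \<subseteq> E"
  shows "f (insert x T) = f T"
proof -
  have "f (insert x S \<union> T) + f (insert x S \<inter> T) \<le> f (insert x S) + f T"
    using assms by (intro f_submodular) auto
  moreover have "f S \<le> f (insert x S \<inter> T)"
    using assms by (intro f_mono) auto
  moreover have "f T \<le> f (insert x T)"
    using assms by (intro f_mono) auto
  moreover have "insert x S \<union> T = insert x T"
    using assms(2) by auto
  ultimately show ?thesis
    using assms(1) by simp
qed

lemma f_Un_eq_if_insert_eq:
  assumes "finite D" "T \<union> D \<subseteq> E" "\<And>x. x \<in> D \<Longrightarrow> f (insert x T) = f T"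
  shows "f (T \<union> D) = f T"
  using assms
proof (induction rule: finite_induct)
  case empty
  then show ?case by simp
next
  case (insert x D)
  have "f (insert x (T \<union> D)) = f (T \<union> D)"
    by (rule f_insert_eq_superset[of x T]) (use insert.prems in auto)
  also have "\<dots> = f T"
    using insert.prems by (intro insert.IH) auto
  finally show ?case by simp
qed

definition tight :: "'a set \<Rightarrow> 'a set \<Rightarrow> bool" where
  "tight I T \<longleftrightarrow> T \<subseteq> I \<and> card T = f T"

lemma tight_Un:
  assumes I: "I \<in> count_matroid f E" and "tight I S" "tight I T"
  shows "tight I (S \<union> T)"
proof -
  have subsets: "S \<union> T \<subseteq> I" "I \<subseteq> E" and tight_cards: "card S = f S" "card T = f T"
    using assms by (auto simp: tight_def mem_count_matroid_iff)
  have "finite (S \<union> T)"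
    using subsets finite_ground by (meson finite_subset)
  then have "card (S \<union> T) + card (S \<inter> T) = f S + f T"
    using card_Un_Int[of S T] tight_cards by simp
  moreover have "f (S \<union> T) + f (S \<inter> T) \<le> f S + f T"
    using subsets by (intro f_submodular) auto
  moreover have "card (S \<union> T) \<le> f (S \<union> T)" "card (S \<inter> T) \<le> f (S \<inter> T)"
    using I subsets(1) unfolding mem_count_matroid_iff by blast+
  ultimately show ?thesis
    using subsets(1) by (simp add: tight_def)
qed

lemma greatest_tight_set:
  assumes I: "I \<in> count_matroid f E"
  obtains T where "tight I T" "\<And>S. tight I S \<Longrightarrow> S \<subseteq> T"
proof -
  have "finite I"
    using I finite_ground by (auto simp: mem_count_matroid_iff intro: finite_subset)
  moreover have "{T. tight I T} \<subseteq> Pow I"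
    by (auto simp: tight_def)
  ultimately have "finite {T. tight I T}"
    by (simp add: finite_subset)
  moreover have "{} \<in> {T. tight I T}"
    by (simp add: tight_def f_empty)
  ultimately obtain T where T: "tight I T"
    and maximal: "\<And>S. tight I S \<Longrightarrow> T \<subseteq> S \<Longrightarrow> T = S"
    using finite_has_maximal[of "{T. tight I T}"] by auto
  have "S \<subseteq> T" if "tight I S" for S
    using maximal[OF tight_Un[OF I T that]] by blast
  with T show thesis
    by (rule that)
qed

lemma dependent_element_spanned_by_tight_set:
  assumes I: "I \<in> count_matroid f E" and x: "x \<in> E" "insert x I \<notin> count_matroid f E"
  obtains S where "tight I S" "f (insert x S) = f S"
proof -
  obtain J where J: "J \<subseteq> insert x I" "f J < card J"
    using assms by (auto simp: mem_count_matroid_iff not_le)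
  have "x \<in> J"
    using I J by (auto simp: mem_count_matroid_iff not_le[symmetric])
  define S where "S = J - {x}"
  have J_eq: "J = insert x S" and "S \<subseteq> I"
    using \<open>x \<in> J\<close> J(1) by (auto simp: S_def)
  have J_subset: "J \<subseteq> E"
    using J(1) I x(1) by (auto simp: mem_count_matroid_iff)
  have "card J = Suc (card S)"
    unfolding S_def using finite_subset[OF J_subset finite_ground] \<open>x \<in> J\<close> by (rule card.remove)
  moreover have "card S \<le> f S"
    using I \<open>S \<subseteq> I\<close> by (simp add: mem_count_matroid_iff)
  moreover have "f S \<le> f J"
    using J_subset by (intro f_mono) (auto simp: S_def)
  ultimately have "card S = f S" "f J = f S"
    using J(2) by simp_all
  then show thesis
    using that[of S] \<open>S \<subseteq> I\<close> J_eq by (simp add: tight_def)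
qed

lemma card_basis:
  assumes F_subset: "F \<subseteq> E" and "is_basis (count_matroid f E) F I"
  obtains Z where "Z \<subseteq> F" "card I = card (F - Z) + f Z"
proof -
  have I_subset: "I \<subseteq> F" and I: "I \<in> count_matroid f E"
    and maximal: "\<And>x. x \<in> F - I \<Longrightarrow> insert x I \<notin> count_matroid f E"
    using assms(2) by (auto simp: is_basis_def)
  obtain T where T: "tight I T" and greatest: "\<And>S. tight I S \<Longrightarrow> S \<subseteq> T"
    by (rule greatest_tight_set[OF I]) blast
  then have T_subset: "T \<subseteq> I" and card_T: "card T = f T"
    by (auto simp: tight_def)
  have span: "f (insert x T) = f T" if x: "x \<in> F - I" for x
  proof -
    obtain S where S: "tight I S" "f (insert x S) = f S"
      using dependent_element_spanned_by_tight_set[OF I _ maximal[OF x]] x F_subset by blast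
    show ?thesis
      by (rule f_insert_eq_superset[of x S])
        (use S greatest[of S] x T_subset I_subset F_subset in auto)
  qed
  have finite_F: "finite F"
    using F_subset finite_ground by (rule finite_subset)
  have "f (T \<union> (F - I)) = f T"
    using finite_F F_subset T_subset I_subset span by (intro f_Un_eq_if_insert_eq) auto
  moreover have "F - (T \<union> (F - I)) = I - T"
    using I_subset by auto
  moreover have "card I = card (I - T) + card T"
    using card_Int_Diff[OF finite_subset[OF I_subset finite_F], of T] T_subset
    by (simp add: Int_absorb1)
  ultimately show thesis
    using that[of "T \<union> (F - I)"] card_T T_subset I_subset by auto
qed

lemma card_indep_le:
  assumes J: "J \<in> count_matroid f E" "J \<subseteq> F" and "Z \<subseteq> F" "F \<subseteq> E"
  shows "card J \<le> card (F - Z) + f Z"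
proof -
  have "card J \<le> card (J - Z) + card (J \<inter> Z)"
    by (metis Un_Diff_Int card_Un_le)
  moreover have "card (J - Z) \<le> card (F - Z)"
    using assms finite_ground by (intro card_mono) (auto intro: finite_subset)
  moreover have "card (J \<inter> Z) \<le> f (J \<inter> Z)"
    using J(1) by (simp add: mem_count_matroid_iff)
  moreover have "f (J \<inter> Z) \<le> f Z"
    using assms by (intro f_mono) auto
  ultimately show ?thesis by linarith
qed

lemma matroid_count_matroid: "matroid E (count_matroid f E)"
proof -
  let ?M = "count_matroid f E"
  have "\<exists>x\<in>B - A. insert x A \<in> ?M"
    if A: "A \<in> ?M" and B: "B \<in> ?M" and less: "card A < card B" for A B
  proof (rule ccontr)
    assume "\<not> ?thesis"
    then have "is_basis ?M (A \<union> B) A"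
      using A by (auto simp: is_basis_def)
    moreover have Un_subset: "A \<union> B \<subseteq> E"
      using A B by (auto simp: mem_count_matroid_iff)
    ultimately obtain Z where "Z \<subseteq> A \<union> B" "card A = card (A \<union> B - Z) + f Z"
      using card_basis by metis
    then show False
      using card_indep_le[OF B _ _ Un_subset, of Z] less by simp
  qed
  moreover have "B \<in> ?M" if "A \<in> ?M" "B \<subseteq> A" for A B
    using that unfolding mem_count_matroid_iff by (meson subset_trans)
  moreover have "{} \<in> ?M" "?M \<subseteq> Pow E"
    by (auto simp: mem_count_matroid_iff)
  ultimately show ?thesis
    using finite_ground unfolding matroid_def matroid_on_def by blast
qed

lemma rank_count_matroid:
  assumes "F \<subseteq> E"
  obtains Z where "Z \<subseteq> F" "matroid_rank (count_matroid f E) F = card (F - Z) + f Z"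
proof -
  interpret matroid E "count_matroid f E"
    by (rule matroid_count_matroid)
  obtain I where I: "is_basis (count_matroid f E) F I"
    by (rule basis_exists)
  show thesis
    using card_basis[OF assms I] that rank_eq_card_basis[OF I] by metis
qed

end

lemma polymatroid_f10:
  assumes "finite E" "\<And>e. e \<in> E \<Longrightarrow> finite e"
  shows "polymatroid E f10"
proof
  have finite_Union_subset: "finite (\<Union>A)" if "A \<subseteq> E" for A
    using that assms by (meson finite_Union finite_subset subsetD)
  show "f10 A \<le> f10 B" if "A \<subseteq> B" "B \<subseteq> E" for A B
    unfolding f10_def using that by (intro card_mono finite_Union_subset Union_mono)
  show "f10 (A \<union> B) + f10 (A \<inter> B) \<le> f10 A + f10 B" if "A \<subseteq> E" "B \<subseteq> E" for A B
  proof -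
    have "f10 (A \<inter> B) \<le> card (\<Union>A \<inter> \<Union>B)"
      unfolding f10_def using that finite_Union_subset by (intro card_mono) auto
    then show ?thesis
      using card_Un_Int[of "\<Union>A" "\<Union>B"] that finite_Union_subset
      by (simp add: f10_def)
  qed
qed (use assms in \<open>simp_all add: f10_def\<close>)

section \<open>Complete bipartite graphs\<close>

definition biclique :: "'v set \<Rightarrow> 'v set \<Rightarrow> 'v set set" where
  "biclique U W = {{u, w} | u w. u \<in> U \<and> w \<in> W}"

lemma biclique_commute: "biclique U W = biclique W U"
  unfolding biclique_def by (auto simp: insert_commute)

lemma biclique_mono: "U \<subseteq> U' \<Longrightarrow> W \<subseteq> W' \<Longrightarrow> biclique U W \<subseteq> biclique U' W'"
  unfolding biclique_def by blast

lemma biclique_insert_left: "biclique (insert u U) W = biclique U W \<union> biclique {u} W"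
  unfolding biclique_def by auto

lemma biclique_eq_image: "biclique U W = (\<lambda>(u, w). {u, w}) ` (U \<times> W)"
  unfolding biclique_def by auto

lemma image_biclique: "(\<lambda>e. \<phi> ` e) ` biclique U W = biclique (\<phi> ` U) (\<phi> ` W)"
  by (simp add: biclique_eq_image image_paired_Times[symmetric] image_image case_prod_unfold)

lemma finite_biclique: "finite U \<Longrightarrow> finite W \<Longrightarrow> finite (biclique U W)"
  by (simp add: biclique_eq_image)

lemma card_biclique:
  assumes "U \<inter> W = {}"
  shows "card (biclique U W) = card U * card W"
proof -
  have "inj_on (\<lambda>(u, w). {u, w}) (U \<times> W)"
    using assms by (auto simp: inj_on_def doubleton_eq_iff)
  then show ?thesis
    by (simp add: biclique_eq_image card_image card_cartesian_product)
qed

lemma Union_biclique: "U \<noteq> {} \<Longrightarrow> W \<noteq> {} \<Longrightarrow> \<Union>(biclique U W) = U \<union> W"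
  unfolding biclique_def by blast

lemma subset_biclique_Int_Union:
  assumes "F \<subseteq> biclique U W"
  shows "F \<subseteq> biclique (U \<inter> \<Union>F) (W \<inter> \<Union>F)"
proof
  fix e assume "e \<in> F"
  then have "e \<in> biclique U W"
    using assms by (rule set_rev_mp)
  then obtain u w where "e = {u, w}" "u \<in> U" "w \<in> W"
    unfolding biclique_def by blast
  moreover from this have "u \<in> \<Union>F" "w \<in> \<Union>F"
    using \<open>e \<in> F\<close> by auto
  ultimately show "e \<in> biclique (U \<inter> \<Union>F) (W \<inter> \<Union>F)"
    unfolding biclique_def by blast
qed

lemma f10_eq_card_sides:
  assumes "F \<subseteq> biclique U W" "U \<inter> W = {}" "finite U" "finite W"
  shows "f10 F = card (U \<inter> \<Union>F) + card (W \<inter> \<Union>F)"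
proof -
  have "\<Union>F \<subseteq> U \<union> W"
    using assms(1) by (auto simp: biclique_def)
  then have "\<Union>F = (U \<inter> \<Union>F) \<union> (W \<inter> \<Union>F)"
    by blast
  moreover have "(U \<inter> \<Union>F) \<inter> (W \<inter> \<Union>F) = {}"
    using assms(2) by blast
  ultimately show ?thesis
    unfolding f10_def using assms(3,4) card_Un_disjoint[of "U \<inter> \<Union>F" "W \<inter> \<Union>F"] by simp
qed

lemma mult_le_add_of_small:
  fixes a b :: nat
  assumes "a \<le> 1 \<or> b \<le> 1 \<or> a \<le> 2 \<and> b \<le> 2"
  shows "a * b \<le> a + b"
proof -
  consider "a = 0" | "a = 1" | "b = 0" | "b = 1" | "a = 2" "b = 2"
    using assms by linarith
  then show ?thesis
    by cases auto
qed

lemma card_le_f10_of_psubset_biclique_2_3: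
  assumes UW: "card U = 2" "card W = 3" "U \<inter> W = {}" and I: "I \<subset> biclique U W"
  shows "card I \<le> f10 I"
proof -
  let ?U = "U \<inter> \<Union>I" and ?W = "W \<inter> \<Union>I"
  have finite_sides: "finite U" "finite W"
    using UW by (simp_all add: card_ge_0_finite)
  have f10_I: "f10 I = card ?U + card ?W"
    using I UW(3) finite_sides by (intro f10_eq_card_sides) auto
  have card_bounds: "card ?U \<le> 2" "card ?W \<le> 3"
    using UW finite_sides card_mono[of U ?U] card_mono[of W ?W] by auto
  show ?thesis
  proof (cases "card ?U = 2 \<and> card ?W = 3")
    case True
    have "card I < card (biclique U W)"
      using I finite_sides by (intro psubset_card_mono finite_biclique)
    then show ?thesis
      using True UW f10_I by (simp add: card_biclique)
  next
    case False
    have "card I \<le> card (biclique ?U ?W)"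
      using I finite_sides by (intro card_mono finite_biclique subset_biclique_Int_Union) auto
    also have "\<dots> = card ?U * card ?W"
      using UW(3) by (intro card_biclique) auto
    also have "\<dots> \<le> card ?U + card ?W"
      using False card_bounds by (intro mult_le_add_of_small) linarith
    finally show ?thesis
      by (simp add: f10_I)
  qed
qed

lemma circuit_biclique_2_3:
  assumes UW: "card U = 2" "card W = 3" "U \<inter> W = {}" and E: "biclique U W \<subseteq> E"
  shows "circuit E (count_matroid f10 E) (biclique U W)"
proof -
  let ?X = "biclique U W"
  have "finite U" "finite W" "U \<noteq> {}" "W \<noteq> {}"
    using UW by (auto simp: card_ge_0_finite)
  then have "f10 ?X = 5"
    using UW by (simp add: f10_def Union_biclique card_Un_disjoint)
  moreover have "card ?X = 6"
    using UW by (simp add: card_biclique)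
  ultimately have "?X \<notin> count_matroid f10 E"
    by (auto simp: count_matroid_def dest: spec[of _ ?X])
  moreover have "D \<in> count_matroid f10 E" if "D \<subset> ?X" for D
    using that E card_le_f10_of_psubset_biclique_2_3[OF UW]
    by (auto simp: count_matroid_def)
  ultimately show ?thesis
    using E by (simp add: circuit_def)
qed

definition contains_K23s :: "'v set set set \<Rightarrow> 'v set \<Rightarrow> 'v set \<Rightarrow> bool" where
  "contains_K23s \<X> U W \<longleftrightarrow>
     (\<forall>U' W'. U' \<subseteq> U \<longrightarrow> W' \<subseteq> W \<longrightarrow> {card U', card W'} = {2, 3} \<longrightarrow> biclique U' W' \<in> \<X>)"

lemma contains_K23s_sym:
  assumes "contains_K23s \<X> U W"
  shows "contains_K23s \<X> W U"
  unfolding contains_K23s_def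
proof (intro allI impI)
  fix W' U'
  assume "W' \<subseteq> W" "U' \<subseteq> U" "{card W', card U'} = {2, 3}"
  then have "biclique U' W' \<in> \<X>"
    using assms by (simp add: contains_K23s_def insert_commute)
  then show "biclique W' U' \<in> \<X>"
    by (simp add: biclique_commute)
qed

lemma contains_K23s_mono:
  "contains_K23s \<X> U W \<Longrightarrow> U' \<subseteq> U \<Longrightarrow> W' \<subseteq> W \<Longrightarrow> contains_K23s \<X> U' W'"
  unfolding contains_K23s_def by (meson subset_trans)

lemma val_min_insert_edge_le:
  assumes "finite \<X>" and K23s: "contains_K23s \<X> (insert v U) {w, w'}"
    and U: "2 \<le> card U" "v \<notin> U" and "w \<noteq> w'"
    and F: "biclique U {w, w'} \<subseteq> F" "{v, w'} \<in> F"
  shows "val_min \<X> (insert {v, w} F) \<le> val_min \<X> F"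
proof -
  obtain U' where U': "U' \<subseteq> U" "card U' = 2" "finite U'"
    using U(1) by (rule obtain_subset_with_card_n)
  let ?X = "biclique (insert v U') {w, w'}"
  have "insert v U' \<subseteq> insert v U"
    using U'(1) by blast
  moreover have "v \<notin> U'"
    using U'(1) U(2) by blast
  then have "card (insert v U') = 3" "card {w, w'} = 2"
    using U'(2,3) \<open>w \<noteq> w'\<close> by simp_all
  then have "{card (insert v U'), card {w, w'}} = {2, 3}"
    by (simp add: insert_commute)
  ultimately have "?X \<in> \<X>"
    using K23s unfolding contains_K23s_def by blast
  moreover have "{v, w} \<in> ?X"
    by (auto simp: biclique_def)
  moreover have "?X \<subseteq> insert {v, w} F"
  proof -
    have "biclique U' {w, w'} \<subseteq> F"
      using biclique_mono[OF U'(1) subset_refl] F(1) by (rule subset_trans)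
    moreover have "biclique {v} {w, w'} \<subseteq> insert {v, w} F"
      using F(2) by (auto simp: biclique_def)
    ultimately show ?thesis
      unfolding biclique_insert_left[of v U'] by blast
  qed
  ultimately show ?thesis
    by (rule val_min_insert_le[OF \<open>finite \<X>\<close>])
qed

lemma val_min_biclique_insert_le:
  assumes "finite \<X>" "finite W" and U: "2 \<le> card U" "v \<notin> U"
    and K23s: "contains_K23s \<X> (insert v U) W"
  shows "val_min \<X> (biclique (insert v U) W) \<le> val_min \<X> (biclique U W) + 1"
proof -
  let ?G = "biclique U W"
  have "val_min \<X> (?G \<union> biclique {v} C) \<le> val_min \<X> ?G + 1" if "finite C" "C \<subseteq> W" for C
    using that
  proof (induction C rule: finite_induct)
    case empty
    then show ?case by (simp add: biclique_def)
  next
    case (insert w C)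
    show ?case
    proof (cases "C = {}")
      case True
      then have "biclique {v} (insert w C) = {{v, w}}"
        by (simp add: biclique_def)
      then show ?thesis
        using val_min_Un_le[OF \<open>finite \<X>\<close>, of ?G "{{v, w}}"] by simp
    next
      case False
      then obtain w' where "w' \<in> C" by blast
      then have w': "w \<noteq> w'" "{w, w'} \<subseteq> W" "{v, w'} \<in> biclique {v} C"
        using insert.hyps(2) insert.prems by (auto simp: biclique_def)
      let ?F = "?G \<union> biclique {v} C"
      have "val_min \<X> (insert {v, w} ?F) \<le> val_min \<X> ?F"
      proof (rule val_min_insert_edge_le[OF \<open>finite \<X>\<close> _ U w'(1)])
        show "contains_K23s \<X> (insert v U) {w, w'}"
          using K23s subset_refl w'(2) by (rule contains_K23s_mono)
        show "biclique U {w, w'} \<subseteq> ?F"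
          using biclique_mono[OF subset_refl w'(2)] by (rule le_supI1)
      qed (use w'(3) in blast)
      moreover have "?G \<union> biclique {v} (insert w C) = insert {v, w} ?F"
        by (auto simp: biclique_def)
      ultimately show ?thesis
        using insert.IH insert.prems by simp
    qed
  qed
  from this[OF \<open>finite W\<close> subset_refl] show ?thesis
    by (simp add: biclique_insert_left[of v U])
qed

lemma val_min_biclique_Un_le:
  assumes "finite \<X>" "finite W" and U: "2 \<le> card U" and "finite D"
    and "U \<inter> D = {}" "contains_K23s \<X> (U \<union> D) W"
  shows "val_min \<X> (biclique (U \<union> D) W) \<le> val_min \<X> (biclique U W) + int (card D)"
  using assms(4-)
proof (induction D rule: finite_induct)
  case empty
  then show ?case by simp
next
  case (insert v D)
  have "finite U"
    using U by (intro card_ge_0_finite) simp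
  then have "card U \<le> card (U \<union> D)"
    using insert.hyps(1) by (intro card_mono) auto
  then have "val_min \<X> (biclique (insert v (U \<union> D)) W) \<le> val_min \<X> (biclique (U \<union> D) W) + 1"
    using U insert.hyps insert.prems \<open>finite \<X>\<close> \<open>finite W\<close>
    by (intro val_min_biclique_insert_le) auto
  moreover have "val_min \<X> (biclique (U \<union> D) W) \<le> val_min \<X> (biclique U W) + int (card D)"
  proof (rule insert.IH)
    show "contains_K23s \<X> (U \<union> D) W"
      using insert.prems(2) by (rule contains_K23s_mono) auto
  qed (use insert.prems(1) in blast)
  ultimately show ?case
    using insert.hyps by simp
qed

lemma val_min_biclique_le:
  assumes "finite \<X>" "finite U" "finite W" "U \<inter> W = {}" and K23s: "contains_K23s \<X> U W"
  shows "val_min \<X> (biclique U W) \<le> int (card U + card W)"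
proof (cases "2 \<le> card U \<and> 2 \<le> card W")
  case True
  then obtain U' W' where U': "U' \<subseteq> U" "card U' = 2" "finite U'"
    and W': "W' \<subseteq> W" "card W' = 2" "finite W'"
    by (meson obtain_subset_with_card_n)
  have card_Diff: "card (U - U') = card U - 2" "card (W - W') = card W - 2"
    using U' W' by (simp_all add: card_Diff_subset)
  have "val_min \<X> (biclique U W) \<le> val_min \<X> (biclique U' W) + int (card (U - U'))"
    using val_min_biclique_Un_le[of \<X> W U' "U - U'"] assms U'(2)
    by (simp add: Un_absorb1[OF U'(1)])
  moreover have "contains_K23s \<X> W U'"
    using contains_K23s_mono[OF K23s U'(1) subset_refl] by (rule contains_K23s_sym)
  then have "val_min \<X> (biclique W U') \<le> val_min \<X> (biclique W' U') + int (card (W - W'))"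
    using val_min_biclique_Un_le[of \<X> U' W' "W - W'"] assms U'(3) W'(2)
    by (simp add: Un_absorb1[OF W'(1)])
  moreover have "val_min \<X> (biclique W' U') \<le> 4"
  proof -
    have "W' \<inter> U' = {}"
      using U'(1) W'(1) assms(4) by blast
    then show ?thesis
      using val_min_le_card[OF \<open>finite \<X>\<close>, of "biclique W' U'"] U'(2) W'(2)
      by (simp add: card_biclique)
  qed
  ultimately show ?thesis
    using True card_Diff by (simp add: biclique_commute[of U' W])
next
  case False
  then have "card (biclique U W) \<le> card U + card W"
    using assms(4) by (subst card_biclique) (auto intro: mult_le_add_of_small)
  then show ?thesis
    using val_min_le_card[OF \<open>finite \<X>\<close>, of "biclique U W"] by linarith
qed

section \<open>Copies of \<open>K\<^sub>2\<^sub>,\<^sub>3\<close> in \<open>K\<^sub>m\<^sub>,\<^sub>n\<close>\<close>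

lemma K_edges_eq_biclique: "K_edges m n = biclique (Inl ` {..<m}) (Inr ` {..<n})"
  unfolding K_edges_def biclique_def by blast

lemma K23_copies_eq:
  "K23_copies m n =
     {biclique U W | U W. biclique U W \<subseteq> K_edges m n \<and> card U = 2 \<and> card W = 3 \<and> U \<inter> W = {}}"
  (is "_ = ?R")
proof (intro subset_antisym subsetI)
  let ?A = "Inl ` {..<2} :: (nat + nat) set" and ?B = "Inr ` {..<3} :: (nat + nat) set"
  fix X assume "X \<in> K23_copies m n"
  then obtain \<phi> where X: "X \<subseteq> K_edges m n" "X = biclique (\<phi> ` ?A) (\<phi> ` ?B)"
    and inj: "inj_on \<phi> (?A \<union> ?B)"
    by (auto simp: K23_copies_def K_edges_eq_biclique[of 2 3] image_biclique K_verts_def)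
  have "card (\<phi> ` ?A) = 2" "card (\<phi> ` ?B) = 3"
    using inj by (simp_all add: card_image inj_on_Un)
  moreover have "\<phi> ` ?A \<inter> \<phi> ` ?B = {}"
    using inj_on_image_Int[OF inj, of ?A ?B] by auto
  ultimately show "X \<in> ?R"
    using X by blast
next
  fix X assume "X \<in> ?R"
  then obtain U W where X: "X = biclique U W" "X \<subseteq> K_edges m n"
    and cards: "card U = 2" "card W = 3" and disjoint: "U \<inter> W = {}"
    by blast
  obtain f where f: "bij_betw f {..<2::nat} U"
    using ex_bij_betw_nat_finite[of U] cards(1) by (auto simp: card_ge_0_finite lessThan_atLeast0)
  obtain g where g: "bij_betw g {..<3::nat} W"
    using ex_bij_betw_nat_finite[of W] cards(2) by (auto simp: card_ge_0_finite lessThan_atLeast0)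
  have "f i \<noteq> g j" if "i < 2" "j < 3" for i j
    using f g disjoint that by (auto simp: bij_betw_def)
  then have "inj_on (case_sum f g) (K_verts 2 3)"
    using f g unfolding K_verts_def bij_betw_def inj_on_def by fastforce
  moreover have "X = (\<lambda>e. case_sum f g ` e) ` K_edges 2 3"
    using f g X(1) by (simp add: K_edges_eq_biclique image_biclique image_image bij_betw_def)
  ultimately show "X \<in> K23_copies m n"
    using X(2) unfolding K23_copies_def by blast
qed

lemma contains_K23s_K23_copies: "contains_K23s (K23_copies m n) (Inl ` {..<m}) (Inr ` {..<n})"
  unfolding contains_K23s_def
proof (intro allI impI)
  fix U W :: "(nat + nat) set"
  assume sides: "U \<subseteq> Inl ` {..<m}" "W \<subseteq> Inr ` {..<n}" and "{card U, card W} = {2, 3}"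
  then consider "card U = 2" "card W = 3" | "card U = 3" "card W = 2"
    by (auto simp: doubleton_eq_iff)
  moreover have "biclique U W \<subseteq> K_edges m n"
    unfolding K_edges_eq_biclique using sides by (rule biclique_mono)
  moreover have "U \<inter> W = {}"
    using sides by auto
  ultimately show "biclique U W \<in> K23_copies m n"
    unfolding K23_copies_eq using biclique_commute[of U W] by cases blast+
qed

lemma finite_K23_copy: "X \<in> K23_copies m n \<Longrightarrow> finite X"
  using finite_K_edges by (auto simp: K23_copies_def intro: finite_subset)

lemma polymatroid_K_edges: "polymatroid (K_edges m n) f10"
  using finite_K_edges by (rule polymatroid_f10) (auto simp: K_edges_def)

lemma K23_matroid_iff:
  "K23_matroid m n M \<longleftrightarrow> matroid_with_circuits (K_edges m n) M (K23_copies m n)"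
  by (simp add: K23_matroid_def matroid_with_circuits_def matroid_def
      matroid_with_circuits_axioms_def Ball_def)

lemma K23_matroid_M_f10: "K23_matroid m n (M_f10 m n)"
  unfolding K23_matroid_iff
proof (intro matroid_with_circuits.intro matroid_with_circuits_axioms.intro)
  show "matroid (K_edges m n) (M_f10 m n)"
    using polymatroid_K_edges by (rule polymatroid.matroid_count_matroid)
  show "circuit (K_edges m n) (M_f10 m n) X" if "X \<in> K23_copies m n" for X
    using that circuit_biclique_2_3 by (auto simp: K23_copies_eq)
qed

lemma val_K23_le_f10:
  assumes "F \<subseteq> K_edges m n"
  shows "val_K23 m n F \<le> int (f10 F)"
proof -
  let ?L = "Inl ` {..<m} :: (nat + nat) set" and ?R = "Inr ` {..<n} :: (nat + nat) set"
  let ?U = "?L \<inter> \<Union>F" and ?W = "?R \<inter> \<Union>F"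
  have F: "F \<subseteq> biclique ?L ?R" and disjoint: "?L \<inter> ?R = {}"
    using assms by (auto simp: K_edges_eq_biclique)
  have "val_K23 m n F \<le> val_K23 m n (biclique ?U ?W)"
    using F by (intro val_min_mono finite_K23_copies finite_K23_copy finite_biclique
        subset_biclique_Int_Union) auto
  also have "\<dots> \<le> int (card ?U + card ?W)"
  proof (rule val_min_biclique_le[OF finite_K23_copies])
    show "contains_K23s (K23_copies m n) ?U ?W"
      using contains_K23s_K23_copies by (rule contains_K23s_mono) auto
  qed auto
  also have "card ?U + card ?W = f10 F"
    using F disjoint by (intro f10_eq_card_sides[symmetric]) auto
  finally show ?thesis .
qed

lemma val_K23_le_rank:
  assumes "F \<subseteq> K_edges m n"
  shows "val_K23 m n F \<le> int (matroid_rank (M_f10 m n) F)"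
proof -
  obtain Z where Z: "Z \<subseteq> F" "matroid_rank (M_f10 m n) F = card (F - Z) + f10 Z"
    using polymatroid.rank_count_matroid[OF polymatroid_K_edges assms] by blast
  have "val_K23 m n F \<le> val_K23 m n Z + int (card (F - Z))"
    using val_min_Un_le[OF finite_K23_copies, of m n Z "F - Z"] Z(1) by (simp add: Un_absorb1)
  also have "val_K23 m n Z \<le> int (f10 Z)"
    using Z(1) assms by (intro val_K23_le_f10) auto
  finally show ?thesis
    using Z(2) by simp
qed

theorem theorem4p4:
  fixes m n :: nat
  assumes "2 \<le> m" and "2 \<le> n" and "3 \<le> max m n"
  shows "maximal_K23_matroid m n (M_f10 m n)
       \<and> (\<forall>N. maximal_K23_matroid m n N \<longrightarrow> N = M_f10 m n)
       \<and> (\<forall>F. F \<subseteq> K_edges m n \<longrightarrow> val_K23 m n F = int (matroid_rank (M_f10 m n) F))"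
proof (intro conjI allI impI)
  interpret M_f10: matroid_with_circuits "K_edges m n" "M_f10 m n" "K23_copies m n"
    using K23_matroid_M_f10 by (simp add: K23_matroid_iff)
  have largest: "weak_le N (M_f10 m n)" if "K23_matroid m n N" for N
    using that M_f10.matroid_axioms val_K23_le_rank
    unfolding K23_matroid_iff by (rule matroid_with_circuits.weak_le_if_val_min_le_rank)
  show "maximal_K23_matroid m n (M_f10 m n)"
    using K23_matroid_M_f10 largest unfolding maximal_K23_matroid_def weak_le_def by blast
  show "N = M_f10 m n" if "maximal_K23_matroid m n N" for N
    using that K23_matroid_M_f10 largest unfolding maximal_K23_matroid_def by metis
  show "val_K23 m n F = int (matroid_rank (M_f10 m n) F)" if "F \<subseteq> K_edges m n" for F
    using val_K23_le_rank[OF that] M_f10.rank_le_val_min[OF that] by (rule order_antisym)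
qed

end
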